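(* Let $r,n\ge 1$ be integers, let $s\in\{1,\dots,r\}$ and let $k\in\{0,1,\dots,n\}$. Let $\mathcal{B}$ be the family of all words $w\in[s]^n$ in which the symbol $s$ appears at most $k$ times. Then for every family $\mathcal{F}\subseteq[r]^n$ with $|\mathcal{F}|=|\mathcal{B}|$ we have $|\Delta\mathcal{F}|\ge|\Delta\mathcal{B}|$. That is, $\mathcal{B}$ has minimal deletion shadow among all families in $[r]^n$ of the same size.
   Context: Words of length $n$ over the alphabet $[r]=\{1,\dots,r\}$ are elements of $[r]^n$. For a family $\mathcal{F}\subseteq[r]^n$ and $i\in[n]$, the deletion shadow in direction $i$ is $\delta_i\mathcal{F}=\{(x_1,\dots,x_{i-1},x_{i+1},\dots,x_n):(x_1,\dots,x_n)\in\mathcal{F}\}\subseteq[r]^{n-1}$, and the deletion shadow is $\Delta\mathcal{F}=\bigcup_{i=1}^n\delta_i\mathcal{F}$, i.e. the set of all words obtainable by deleting one letter from a word of $\mathcal{F}$. *)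

theory Defs
  imports Main
begin

definition words :: "nat \<Rightarrow> nat \<Rightarrow> nat list set" where
  "words r n = {w. length w = n \<and> set w \<subseteq> {1..r}}"

definition delta_i :: "nat \<Rightarrow> nat list set \<Rightarrow> nat list set" where
  "delta_i i F = (\<lambda>w. take i w @ drop (Suc i) w) ` F"

definition deletion_shadow :: "nat \<Rightarrow> nat list set \<Rightarrow> nat list set" where
  "deletion_shadow n F = (\<Union>i<n. delta_i i F)"

definition B_family :: "nat \<Rightarrow> nat \<Rightarrow> nat \<Rightarrow> nat list set" where
  "B_family s n k = {w \<in> words s n. count_list w s \<le> k}"

end

theory Submission
  imports Defs "HOL-Analysis.Convex"
begin

text \<open>
  Put \<open>t = s - 1\<close> and interpolate the ball sizes \<open>|B(n,s,k)|\<close> linearly in \<open>k\<close> by a function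
  \<open>vol t n\<close> with \<open>vol t n (k + 1) = |B(n,s,k)|\<close>. We show by induction on \<open>n\<close>, for every real \<open>u\<close>,
  that \<open>|F| \<ge> vol t n u\<close> implies \<open>|\<Delta>F| \<ge> H\<close>, where \<open>H = vol t (n - 1) u\<close>. Split \<open>F\<close> by
  the first letter into sections \<open>F\<^sub>a\<close>. Deleting the first letter gives \<open>|\<Delta>F| \<ge> |F\<^sub>a|\<close>, so we may
  assume \<open>|F\<^sub>a| \<le> H\<close> for all \<open>a\<close>; deleting a later letter gives \<open>|\<Delta>F| \<ge> \<Sum>\<^sub>a |\<Delta>F\<^sub>a|\<close>. The
  correspondence \<open>vol t m u \<mapsto> vol t (m - 1) u\<close> is a concave function \<open>g\<^sub>m\<close>, because the ratio
  \<open>(m - k) / (m t)\<close> of the slopes on \<open>[k, k + 1]\<close> decreases in \<open>k\<close>. Hence under the constraint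
  \<open>|F\<^sub>a| \<le> H\<close> the sum of the \<open>g\<^sub>m(|F\<^sub>a|)\<close>, with \<open>m = n - 1\<close>, is minimal when \<open>t\<close> sections have
  size \<open>H\<close> and one has the remaining size \<open>vol t m (u - 1)\<close>, and there Pascal's rule makes the sum
  equal to \<open>H\<close>.
\<close>

section \<open>Interpolated ball sizes\<close>

definition ramp :: "real \<Rightarrow> real" where
  "ramp u = max 0 (min 1 u)"

text \<open>The coefficient counts the words with exactly \<open>k\<close> symbols \<open>s\<close>;
  this layer fills up linearly as \<open>u\<close> runs from \<open>k\<close> to
  \<open>k + 1\<close>.\<close>

definition vol :: "real \<Rightarrow> nat \<Rightarrow> real \<Rightarrow> real" where
  "vol t n u = (\<Sum>k\<le>n. real (n choose k) * t ^ (n - k) * ramp (u - real k))"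

lemma ramp_mono: "u \<le> v \<Longrightarrow> ramp u \<le> ramp v"
  by (auto simp: ramp_def)

lemma vol_mono: "t \<ge> 0 \<Longrightarrow> u \<le> v \<Longrightarrow> vol t n u \<le> vol t n v"
  unfolding vol_def by (intro sum_mono mult_left_mono ramp_mono) auto

lemma vol_nonpos: "u \<le> 0 \<Longrightarrow> vol t n u = 0"
  unfolding vol_def by (intro sum.neutral) (auto simp: ramp_def)

lemma vol_nonneg: "t \<ge> 0 \<Longrightarrow> vol t n u \<ge> 0"
  unfolding vol_def by (intro sum_nonneg) (auto simp: ramp_def)

lemma vol_0: "vol t 0 u = ramp u"
  by (simp add: vol_def)

lemma continuous_on_vol: "continuous_on A (vol t n)"
  unfolding vol_def ramp_def by (intro continuous_intros)

text \<open>Pascal's rule: a word starts with one of \<open>t\<close> ordinary letters, or with the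
  counted letter, which uses up one unit of \<open>u\<close>.\<close>

lemma vol_Suc: "vol t (Suc n) u = t * vol t n u + vol t n (u - 1)"
proof -
  define c where "c k = real (n choose k) * t ^ (n - k)" for k
  define d where "d k = real (Suc n choose k) * t ^ (Suc n - k)" for k
  have d0: "d 0 = t * c 0" by (simp add: c_def d_def)
  have dS: "d (Suc k) = t * c (Suc k) + c k" for k
  proof (cases "Suc k \<le> n")
    case True
    then have "n - k = Suc (n - Suc k)" by simp
    then show ?thesis by (simp add: c_def d_def algebra_simps)
  next
    case False
    then show ?thesis by (simp add: c_def d_def)
  qed
  have "vol t (Suc n) u = d 0 * ramp u + (\<Sum>k\<le>n. d (Suc k) * ramp (u - real (Suc k)))"
    unfolding vol_def d_def[symmetric] by (simp only: sum.atMost_Suc_shift) simp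
  also have "\<dots> = t * (c 0 * ramp u + (\<Sum>k\<le>n. c (Suc k) * ramp (u - real (Suc k))))
      + (\<Sum>k\<le>n. c k * ramp (u - 1 - real k))"
    by (simp add: d0 dS algebra_simps sum.distrib sum_distrib_left)
  also have "c 0 * ramp u + (\<Sum>k\<le>n. c (Suc k) * ramp (u - real (Suc k)))
      = (\<Sum>k\<le>Suc n. c k * ramp (u - real k))"
    by (simp only: sum.atMost_Suc_shift) simp
  also have "\<dots> = (\<Sum>k\<le>n. c k * ramp (u - real k))"
    by (simp add: c_def)
  finally show ?thesis unfolding vol_def c_def by simp
qed

section \<open>The concave lower bound for shadow sizes\<close>

text \<open>\<open>slope t p j\<close> is the slope of \<open>vol t (Suc p) u \<mapsto> vol t p u\<close> for \<open>u\<close> in \<open>[j, j + 1]\<close>.\<close>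

definition slope :: "real \<Rightarrow> nat \<Rightarrow> nat \<Rightarrow> real" where
  "slope t p j = (real (Suc p) - real j) / (real (Suc p) * t)"

text \<open>The \<open>j\<close>-th linear piece extended to a full line, anchored at its breakpoint
  \<open>u = j\<close>.\<close>

definition tangent :: "real \<Rightarrow> nat \<Rightarrow> nat \<Rightarrow> real \<Rightarrow> real" where
  "tangent t p j x = vol t p (real j) + slope t p j * (x - vol t (Suc p) (real j))"

text \<open>Encoded as a minimum of lines, so that concavity comes for free.\<close>

definition profile :: "real \<Rightarrow> nat \<Rightarrow> real \<Rightarrow> real" where
  "profile t p x = (MIN j\<in>{..Suc p}. tangent t p j x)"

text \<open>By binomial absorption, \<open>slope t p k\<close> is the ratio of the sizes of layer
  \<open>k\<close> in lengths \<open>p\<close> and \<open>p + 1\<close>.\<close>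

lemma slope_mult_coeff:
  assumes "t > 0" "k \<le> Suc p"
  shows "slope t p k * (real (Suc p choose k) * t ^ (Suc p - k)) = real (p choose k) * t ^ (p - k)"
proof (cases "k = Suc p")
  case True
  then show ?thesis by (simp add: slope_def)
next
  case False
  with assms have k: "k \<le> p" by simp
  have "(Suc p - k) * (Suc p choose k) = Suc p * (p choose k)"
    using binomial_absorb_comp[of "Suc p" k] by simp
  then have "real (Suc p - k) * real (Suc p choose k) = real (Suc p) * real (p choose k)"
    by (metis of_nat_mult)
  then have *: "(real (Suc p) - real k) * real (Suc p choose k) = real (Suc p) * real (p choose k)"
    using assms by (simp add: of_nat_diff)
  have "t ^ (Suc p - k) = t * t ^ (p - k)"
    using k by (simp add: Suc_diff_le)
  then have "slope t p k * (real (Suc p choose k) * t ^ (Suc p - k))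
      = ((real (Suc p) - real k) * real (Suc p choose k)) * t ^ (p - k) / real (Suc p)"
    using assms by (simp add: slope_def del: of_nat_Suc)
  also have "\<dots> = real (p choose k) * t ^ (p - k)"
    unfolding * by (simp del: of_nat_Suc)
  finally show ?thesis .
qed

text \<open>Both volumes are expanded over the layers of length \<open>Suc p\<close>, so that signs
  can be read off term by term.\<close>

lemma tangent_vol_diff:
  assumes "t > 0"
  shows "tangent t p j (vol t (Suc p) u) - vol t p u =
    (\<Sum>k\<le>Suc p. real (Suc p choose k) * t ^ (Suc p - k) * (slope t p j - slope t p k)
       * (ramp (u - real k) - ramp (real j - real k)))"
proof -
  define c where "c k = real (Suc p choose k) * t ^ (Suc p - k)" for k
  have V: "vol t p v = (\<Sum>k\<le>Suc p. slope t p k * c k * ramp (v - real k))" for v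
  proof -
    have "(\<Sum>k\<le>Suc p. slope t p k * c k * ramp (v - real k))
        = (\<Sum>k\<le>Suc p. real (p choose k) * t ^ (p - k) * ramp (v - real k))"
      using assms by (intro sum.cong) (auto simp: slope_mult_coeff c_def simp del: binomial_Suc_Suc)
    also have "\<dots> = vol t p v" by (simp add: vol_def)
    finally show ?thesis by simp
  qed
  have W: "vol t (Suc p) v = (\<Sum>k\<le>Suc p. c k * ramp (v - real k))" for v
    by (simp only: vol_def c_def)
  show ?thesis
    unfolding tangent_def V W c_def[symmetric]
    by (simp only: sum_subtractf[symmetric] sum_distrib_left sum.distrib[symmetric])
       (intro sum.cong refl, simp add: algebra_simps)
qed

lemma slope_diff: "t > 0 \<Longrightarrow> slope t p j - slope t p k = (real k - real j) / (real (Suc p) * t)"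
  by (simp add: slope_def diff_divide_distrib[symmetric] del: of_nat_Suc)

text \<open>Slopes decrease in \<open>k\<close>, while \<open>ramp (j - k)\<close> drops from 1 to 0
  at \<open>k = j\<close>; hence the two differences in a summand never have opposite signs.\<close>

lemma vol_le_tangent:
  assumes "t > 0"
  shows "vol t p u \<le> tangent t p j (vol t (Suc p) u)"
proof -
  have "0 \<le> (slope t p j - slope t p k) * (ramp (u - real k) - ramp (real j - real k))" for k
  proof (cases "k < j")
    case True
    then have "slope t p j - slope t p k \<le> 0"
      using assms by (simp add: slope_diff divide_nonpos_pos del: of_nat_Suc)
    moreover have "ramp (real j - real k) = 1" using True by (simp add: ramp_def)
    ultimately show ?thesis by (intro mult_nonpos_nonpos) (auto simp: ramp_def)
  next
    case False
    then have "slope t p j - slope t p k \<ge> 0"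
      using assms by (simp add: slope_diff del: of_nat_Suc)
    moreover have "ramp (real j - real k) = 0" using False by (simp add: ramp_def)
    ultimately show ?thesis by (intro mult_nonneg_nonneg) (auto simp: ramp_def)
  qed
  then have "0 \<le> tangent t p j (vol t (Suc p) u) - vol t p u"
    unfolding tangent_vol_diff[OF assms] mult.assoc[of _ "slope t p j - _"]
    using assms by (intro sum_nonneg mult_nonneg_nonneg[of "real _ * _"]) auto
  then show ?thesis by simp
qed

lemma vol_eq_tangent:
  assumes "t > 0"
  obtains j where "j \<le> Suc p" "vol t p u = tangent t p j (vol t (Suc p) u)"
proof -
  \<comment> \<open>The piece containing \<open>u\<close>, clamped to the first and last one. Every
    layer \<open>k \<noteq> j\<close> is then full at both \<open>u\<close> and \<open>j\<close> or
    empty at both.\<close>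
  define j where "j = min (Suc p) (nat \<lfloor>u\<rfloor>)"
  have "(slope t p j - slope t p k) * (ramp (u - real k) - ramp (real j - real k)) = 0"
    if "k \<le> Suc p" for k
  proof -
    consider "k < j" | "k = j" | "k > j" by linarith
    then show ?thesis
    proof cases
      case 1
      then have "real k + 1 \<le> u" unfolding j_def by linarith
      with 1 show ?thesis by (simp add: ramp_def)
    next
      case 3
      then have "u \<le> real k" using that unfolding j_def by linarith
      with 3 show ?thesis by (simp add: ramp_def)
    qed simp
  qed
  then have "tangent t p j (vol t (Suc p) u) - vol t p u = 0"
    unfolding tangent_vol_diff[OF assms] mult.assoc[of _ "slope t p j - _"]
    by (intro sum.neutral ballI) (metis atMost_iff mult_zero_right)
  then show ?thesis using that[of j] by (simp add: j_def)
qed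

lemma profile_le: "j \<le> Suc p \<Longrightarrow> profile t p x \<le> tangent t p j x"
  unfolding profile_def by (intro Min_le) auto

lemma profile_attained: obtains j where "j \<le> Suc p" "profile t p x = tangent t p j x"
proof -
  have "profile t p x \<in> (\<lambda>j. tangent t p j x) ` {..Suc p}"
    unfolding profile_def by (intro Min_in) auto
  then show ?thesis using that by auto
qed

lemma profile_vol:
  assumes "t > 0"
  shows "profile t p (vol t (Suc p) u) = vol t p u"
proof (rule antisym)
  show "profile t p (vol t (Suc p) u) \<le> vol t p u"
    using vol_eq_tangent[OF assms, of p u] profile_le by metis
  show "vol t p u \<le> profile t p (vol t (Suc p) u)"
    using profile_attained[of p t "vol t (Suc p) u"] vol_le_tangent[OF assms] by metis
qed

lemma profile_mono:
  assumes "t > 0" "x \<le> y"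
  shows "profile t p x \<le> profile t p y"
proof -
  obtain j where j: "j \<le> Suc p" "profile t p y = tangent t p j y"
    by (rule profile_attained)
  have "slope t p j \<ge> 0" using j assms by (simp add: slope_def del: of_nat_Suc)
  then have "tangent t p j x \<le> tangent t p j y"
    using assms by (simp add: tangent_def mult_left_mono)
  with profile_le[OF j(1), of t x] j(2) show ?thesis by simp
qed

lemma concave_on_profile: "concave_on UNIV (profile t p)"
  unfolding concave_on_iff
proof (intro conjI ballI allI impI)
  fix x y a b :: real
  assume ab: "a \<ge> 0" "b \<ge> 0" "a + b = 1"
  obtain j where j: "j \<le> Suc p"
      "profile t p (a *\<^sub>R x + b *\<^sub>R y) = tangent t p j (a *\<^sub>R x + b *\<^sub>R y)"
    by (rule profile_attained)
  have "tangent t p j (a *\<^sub>R x + b *\<^sub>R y)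
      = (a + b) * vol t p (real j) + slope t p j * (a * x + b * y - (a + b) * vol t (Suc p) (real j))"
    using ab(3) by (simp add: tangent_def)
  also have "\<dots> = a * tangent t p j x + b * tangent t p j y"
    by (simp add: tangent_def algebra_simps)
  also have "\<dots> \<ge> a * profile t p x + b * profile t p y"
    using ab j(1) by (intro add_mono mult_left_mono profile_le)
  finally show "a * profile t p x + b * profile t p y \<le> profile t p (a *\<^sub>R x + b *\<^sub>R y)"
    by (simp only: j(2))
qed auto

lemma profile_0: "t > 0 \<Longrightarrow> profile t p 0 = 0"
  using profile_vol[of t p 0] by (simp add: vol_nonpos)

section \<open>Minimising a sum of concave functions over a truncated simplex\<close>

text \<open>\<open>x\<close> and \<open>y\<close> are convex combinations of \<open>a\<close> and
  \<open>b\<close> with swapped weights; the two concavity inequalities add up.\<close>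

lemma concave_on_exchange:
  fixes g :: "real \<Rightarrow> real"
  assumes "concave_on UNIV g" "a \<le> x" "x \<le> b" "x + y = a + b"
  shows "g a + g b \<le> g x + g y"
proof (cases "a = b")
  case True
  then show ?thesis using assms by auto
next
  case False
  define l where "l = (b - x) / (b - a)"
  have l: "l \<ge> 0" "1 - l \<ge> 0" using assms False by (auto simp: l_def field_simps)
  have "l * (b - a) = b - x" using False by (simp add: l_def)
  then have x: "x = l * a + (1 - l) * b" by (simp add: algebra_simps)
  then have y: "y = (1 - l) * a + l * b" using assms(4) by (simp add: algebra_simps)
  have C: "u * g a + v * g b \<le> g (u * a + v * b)" if "u \<ge> 0" "v \<ge> 0" "u + v = 1" for u v
    using assms(1) that unfolding concave_on_iff by auto
  have "l * g a + (1 - l) * g b \<le> g x" unfolding x using l by (intro C) auto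
  moreover have "(1 - l) * g a + l * g b \<le> g y" unfolding y using l by (intro C) auto
  ultimately show ?thesis by (simp add: algebra_simps)
qed

text \<open>Entries are removed one at a time. If \<open>x i \<le> R\<close>, the pair
  \<open>x i, R - x i\<close> is exchanged for \<open>0, R\<close>; otherwise
  \<open>x i, R + H - x i\<close> is exchanged for \<open>R, H\<close>, using up one of the
  \<open>q\<close> full slots. With no slot left, monotonicity suffices.\<close>

lemma concave_sum_ge:
  fixes g :: "real \<Rightarrow> real"
  assumes g: "concave_on UNIV g" "mono g" "g 0 = 0"
    and "finite A" "\<And>i. i \<in> A \<Longrightarrow> 0 \<le> x i \<and> x i \<le> H"
    and "0 \<le> R" "R \<le> H" "real q * H + R \<le> (\<Sum>i\<in>A. x i)"
  shows "real q * g H + g R \<le> (\<Sum>i\<in>A. g (x i))"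
  using assms(4-)
proof (induction A arbitrary: q R rule: finite_induct)
  case empty
  then have "real q * H \<le> 0" "0 \<le> real q * H" "0 \<le> H" by auto
  then have "real q * H = 0" "R = 0" using empty by auto
  then show ?case using g(3) by auto
next
  case (insert i A)
  let ?z = "x i"
  have z: "0 \<le> ?z" "?z \<le> H" using insert.prems(1) by auto
  have pos: "0 \<le> g (x j)" if "j \<in> A" for j
    using monoD[OF g(2), of 0 "x j"] insert.prems(1) that g(3) by auto
  have sum: "real q * H + R - ?z \<le> (\<Sum>j\<in>A. x j)"
    using insert.prems(4) insert.hyps by simp
  consider "?z \<le> R" | "R < ?z" "q = 0" | "R < ?z" "q > 0" by linarith
  then have "real q * g H + g R \<le> g ?z + (\<Sum>j\<in>A. g (x j))"
  proof cases
    case 1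
    have "R - ?z \<le> H" using z insert.prems(3) by linarith
    then have "real q * g H + g (R - ?z) \<le> (\<Sum>j\<in>A. g (x j))"
      using 1 sum insert.prems(1) by (intro insert.IH) auto
    moreover have "g 0 + g R \<le> g ?z + g (R - ?z)"
      using 1 z by (intro concave_on_exchange[OF g(1)]) auto
    ultimately show ?thesis using g(3) by simp
  next
    case 2
    then show ?thesis using monoD[OF g(2), of R ?z] sum_nonneg[OF pos] by fastforce
  next
    case 3
    then obtain q' where q': "q = Suc q'" by (cases q) auto
    have "0 \<le> R + H - ?z" "R + H - ?z \<le> H" using 3 z insert.prems(2) by linarith+
    then have "real q' * g H + g (R + H - ?z) \<le> (\<Sum>j\<in>A. g (x j))"
      using sum insert.prems(1) by (intro insert.IH) (auto simp: q' algebra_simps)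
    moreover have "g R + g H \<le> g ?z + g (R + H - ?z)"
      using 3 z by (intro concave_on_exchange[OF g(1)]) auto
    ultimately show ?thesis by (simp add: q' algebra_simps)
  qed
  then show ?case using insert.hyps by simp
qed

section \<open>Shadows by first letter\<close>

definition section_at :: "nat \<Rightarrow> nat list set \<Rightarrow> nat list set" where
  "section_at a F = {w. a # w \<in> F}"

lemma finite_words: "finite (words r n)"
proof -
  have "words r n = {w. set w \<subseteq> {1..r} \<and> length w = n}" by (auto simp: words_def)
  then show ?thesis by (simp add: finite_lists_length_eq)
qed

lemma words_0: "words r 0 = {[]}"
  by (auto simp: words_def)

lemma finite_deletion_shadow: "finite F \<Longrightarrow> finite (deletion_shadow n F)"
  by (simp add: deletion_shadow_def delta_i_def)

lemma section_at_words: "F \<subseteq> words r (Suc n) \<Longrightarrow> section_at a F \<subseteq> words r n"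
  unfolding section_at_def words_def by (force simp del: atLeastAtMost_iff)

lemma card_UN_Cons:
  assumes "finite A" "\<And>a. a \<in> A \<Longrightarrow> finite (S a)"
  shows "card (\<Union>a\<in>A. Cons a ` S a) = (\<Sum>a\<in>A. card (S a))"
  using assms by (subst card_UN_disjoint) (auto simp: card_image)

lemma card_eq_sum_sections:
  assumes "F \<subseteq> words r (Suc n)"
  shows "card F = (\<Sum>a\<in>{1..r}. card (section_at a F))"
proof -
  have "w \<in> (\<Union>a\<in>{1..r}. Cons a ` section_at a F)" if "w \<in> F" for w
  proof -
    have "length w = Suc n" "set w \<subseteq> {1..r}" using that assms by (auto simp: words_def)
    then show ?thesis using that by (cases w) (auto simp: section_at_def)
  qed
  then have "F = (\<Union>a\<in>{1..r}. Cons a ` section_at a F)"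
    by (auto simp: section_at_def)
  then show ?thesis
    using card_UN_Cons[of "{1..r}" "\<lambda>a. section_at a F"]
      finite_subset[OF section_at_words[OF assms] finite_words] by simp
qed

lemma section_at_subset_shadow: "section_at a F \<subseteq> deletion_shadow (Suc n) F"
  unfolding section_at_def deletion_shadow_def delta_i_def by force

lemma Cons_shadow_section:
  assumes "v \<in> deletion_shadow n (section_at a F)"
  shows "a # v \<in> deletion_shadow (Suc n) F"
proof -
  obtain i w where "i < n" "a # w \<in> F" "v = take i w @ drop (Suc i) w"
    using assms by (auto simp: deletion_shadow_def delta_i_def section_at_def)
  then have "Suc i < Suc n" "a # v = take (Suc i) (a # w) @ drop (Suc (Suc i)) (a # w)" by auto
  then show ?thesis using \<open>a # w \<in> F\<close>
    unfolding deletion_shadow_def delta_i_def by blast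
qed

text \<open>Restoring the first letter makes the shadows of different sections disjoint, so their
  sizes add.\<close>

lemma sum_card_shadow_sections_le:
  assumes "F \<subseteq> words r (Suc n)"
  shows "(\<Sum>a\<in>{1..r}. card (deletion_shadow n (section_at a F))) \<le> card (deletion_shadow (Suc n) F)"
proof -
  have fin: "finite F" "\<And>a. finite (section_at a F)"
    using assms section_at_words[OF assms] finite_words finite_subset by blast+
  have "(\<Sum>a\<in>{1..r}. card (deletion_shadow n (section_at a F)))
      = card (\<Union>a\<in>{1..r}. Cons a ` deletion_shadow n (section_at a F))"
    using fin by (simp add: card_UN_Cons finite_deletion_shadow)
  also have "\<dots> \<le> card (deletion_shadow (Suc n) F)"
    using fin by (intro card_mono finite_deletion_shadow) (auto intro: Cons_shadow_section)
  finally show ?thesis .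
qed

text \<open>
  The assumption \<open>t > 0\<close> is essential: for \<open>t = 0\<close> and \<open>u = p + 1\<close>, the empty family is a counterexample.
  The case \<open>s = 1\<close> is therefore separate in the theorem.
\<close>

lemma shadow_lower_bound:
  fixes t :: nat
  assumes "t > 0" "F \<subseteq> words r (Suc p)" "vol (real t) (Suc p) u \<le> real (card F)"
  shows "vol (real t) p u \<le> real (card (deletion_shadow (Suc p) F))"
  using assms(2,3)
proof (induction p arbitrary: F u)
  case 0
  show ?case
  proof (cases "F = {}")
    case True
    then have "real t * ramp u + ramp (u - 1) \<le> 0"
      using 0 by (simp add: vol_Suc vol_0)
    moreover have "ramp u \<ge> 0" "ramp (u - 1) \<ge> 0" by (auto simp: ramp_def)
    ultimately have "real t * ramp u \<le> 0" by linarith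
    then have "ramp u \<le> 0" using assms(1) by (simp add: mult_le_0_iff)
    then show ?thesis by (simp add: vol_0)
  next
    case False
    have fin: "finite F" using 0 finite_words finite_subset by blast
    have "deletion_shadow (Suc 0) F \<noteq> {}"
      using False by (auto simp: deletion_shadow_def delta_i_def)
    then have "card (deletion_shadow (Suc 0) F) > 0"
      using fin by (simp add: card_gt_0_iff finite_deletion_shadow)
    moreover have "ramp u \<le> 1" by (simp add: ramp_def)
    ultimately show ?thesis by (simp add: vol_0)
  qed
next
  case (Suc p)
  let ?t = "real t"
  have t: "?t > 0" using assms(1) by simp
  define H where "H = vol ?t (Suc p) u"
  define R where "R = vol ?t (Suc p) (u - 1)"
  define x where "x a = real (card (section_at a F))" for a
  have finF: "finite F" using Suc.prems finite_words finite_subset by blast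
  have sec: "section_at a F \<subseteq> words r (Suc p)" for a
    by (rule section_at_words[OF Suc.prems(1)])
  show ?case
  proof (cases "\<exists>a. x a \<ge> H")
    case True
    then obtain a where "H \<le> x a" by blast
    also have "x a \<le> real (card (deletion_shadow (Suc (Suc p)) F))"
      unfolding x_def
      by (intro of_nat_mono card_mono finite_deletion_shadow finF section_at_subset_shadow)
    finally show ?thesis by (simp add: H_def)
  next
    case False
    have IH: "profile ?t p (x a) \<le> real (card (deletion_shadow (Suc p) (section_at a F)))" for a
    proof -
      \<comment> \<open>The induction hypothesis speaks of values of \<open>vol\<close>, so
        \<open>x a\<close> is realised as one. The endpoint \<open>max 0 u\<close> keeps the
        interval nonempty for negative \<open>u\<close>.\<close>
      have "\<exists>v. 0 \<le> v \<and> v \<le> max 0 u \<and> vol ?t (Suc p) v = x a"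
      proof (rule IVT')
        show "vol ?t (Suc p) 0 \<le> x a" by (simp add: vol_nonpos x_def)
        have "x a \<le> H" using False by (metis linear)
        also have "\<dots> \<le> vol ?t (Suc p) (max 0 u)"
          unfolding H_def using t by (intro vol_mono) auto
        finally show "x a \<le> vol ?t (Suc p) (max 0 u)" .
      qed (auto intro: continuous_on_vol)
      then obtain v where v: "vol ?t (Suc p) v = x a" by blast
      then have "vol ?t p v \<le> real (card (deletion_shadow (Suc p) (section_at a F)))"
        using Suc.IH[OF sec, of v a] by (simp add: x_def)
      then show ?thesis using profile_vol[OF t, of p v] v by simp
    qed
    \<comment> \<open>Pascal's rule splits the target \<open>H\<close>; the same rule one length
      higher gives \<open>t * H + R \<le> card F\<close>.\<close>
    have "vol ?t (Suc p) u = ?t * vol ?t p u + vol ?t p (u - 1)"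
      by (rule vol_Suc)
    also have "\<dots> = real t * profile ?t p H + profile ?t p R"
      using t by (simp add: H_def R_def profile_vol)
    also have "\<dots> \<le> (\<Sum>a\<in>{1..r}. profile ?t p (x a))"
    proof (rule concave_sum_ge[where g = "profile ?t p" and H = H and R = R and x = x])
      show "mono (profile ?t p)" using t by (intro monoI profile_mono)
      show "real t * H + R \<le> (\<Sum>a\<in>{1..r}. x a)"
        using Suc.prems(2) card_eq_sum_sections[OF Suc.prems(1)]
        by (simp add: x_def H_def R_def vol_Suc[of _ "Suc p"])
      show "0 \<le> R" "R \<le> H" using t by (auto simp: R_def H_def intro: vol_nonneg vol_mono)
      show "0 \<le> x i \<and> x i \<le> H" if "i \<in> {1..r}" for i
        using False by (auto simp: x_def not_le intro: less_imp_le)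
    qed (use t in \<open>auto simp: profile_0 concave_on_profile\<close>)
    also have "\<dots> \<le> (\<Sum>a\<in>{1..r}. real (card (deletion_shadow (Suc p) (section_at a F))))"
      by (intro sum_mono IH)
    also have "\<dots> \<le> real (card (deletion_shadow (Suc (Suc p)) F))"
      using sum_card_shadow_sections_le[OF Suc.prems(1)] by (metis of_nat_mono of_nat_sum)
    finally show ?thesis .
  qed
qed

section \<open>The extremal family\<close>

text \<open>Splitting by first letter yields the recurrence \<open>vol_Suc\<close>: a leading
  \<open>s\<close> lowers the budget \<open>k\<close> by one.\<close>

lemma card_B_family:
  assumes "s \<ge> 1"
  shows "real (card (B_family s n k)) = vol (real (s - 1)) n (real k + 1)"
proof (induction n arbitrary: k)
  case 0
  have "B_family s 0 k = {[]}" by (auto simp: B_family_def words_0)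
  then show ?case by (simp add: vol_0 ramp_def)
next
  case (Suc n)
  have sub: "B_family s (Suc n) k \<subseteq> words s (Suc n)" by (auto simp: B_family_def)
  have other: "section_at a (B_family s (Suc n) k) = B_family s n k" if "a \<in> {1..s - 1}" for a
    using that by (auto simp: section_at_def B_family_def words_def)
  have last: "real (card (section_at s (B_family s (Suc n) k))) = vol (real (s - 1)) n (real k)"
  \<comment> \<open>For \<open>k = 0\<close> no word may start with \<open>s\<close>, matching
    \<open>vol\<close> at 0.\<close>
  proof (cases k)
    case 0
    then have "section_at s (B_family s (Suc n) k) = {}"
      by (auto simp: section_at_def B_family_def)
    then show ?thesis using 0 by (simp add: vol_nonpos)
  next
    case (Suc k')
    then have "section_at s (B_family s (Suc n) k) = B_family s n k'"
      using assms by (auto simp: section_at_def B_family_def words_def)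
    then show ?thesis using Suc.IH[of k'] Suc by (simp add: add.commute)
  qed
  have "{1..s} = insert s {1..s - 1}" using assms by auto
  then have "card (B_family s (Suc n) k) = card (section_at s (B_family s (Suc n) k))
      + (s - 1) * card (B_family s n k)"
    using assms by (simp add: card_eq_sum_sections[OF sub] other)
  then have "real (card (B_family s (Suc n) k)) = vol (real (s - 1)) n (real k)
      + real (s - 1) * vol (real (s - 1)) n (real k + 1)"
    by (simp only: of_nat_add of_nat_mult last Suc.IH)
  then show ?case by (simp add: vol_Suc)
qed

text \<open>Deleting a letter cannot raise the number of \<open>s\<close>. This bounds the shadow of
  the ball from above, to be set against \<open>shadow_lower_bound\<close>.\<close>

lemma shadow_B_family_subset: "deletion_shadow (Suc p) (B_family s (Suc p) k) \<subseteq> B_family s p k"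
proof
  fix v assume "v \<in> deletion_shadow (Suc p) (B_family s (Suc p) k)"
  then obtain i w where i: "i < Suc p" and w: "w \<in> B_family s (Suc p) k"
    and v: "v = take i w @ drop (Suc i) w"
    by (auto simp: deletion_shadow_def delta_i_def)
  have len: "length w = Suc p" "set w \<subseteq> {1..s}" "count_list w s \<le> k"
    using w by (auto simp: B_family_def words_def)
  have "w = take i w @ w ! i # drop (Suc i) w" using i len by (simp add: id_take_nth_drop)
  then have "count_list w s = count_list (take i w @ w ! i # drop (Suc i) w) s" by simp
  then have "count_list v s \<le> count_list w s" by (simp add: v)
  moreover have "set v \<subseteq> set w" using set_take_subset set_drop_subset by (fastforce simp: v)
  moreover have "length v = p" using i len by (simp add: v)
  ultimately show "v \<in> B_family s p k" using len by (auto simp: B_family_def words_def)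
qed

theorem theorem2:
  fixes r n s k :: nat
  assumes "r \<ge> 1" and "n \<ge> 1"
    and "s \<in> {1..r}" and "k \<le> n"
    and "F \<subseteq> words r n"
    and "card F = card (B_family s n k)"
  shows "card (deletion_shadow n F) \<ge> card (deletion_shadow n (B_family s n k))"
proof -
  obtain p where n: "n = Suc p" using assms(2) by (cases n) auto
  have fin: "finite (B_family s m k)" for m
    by (rule finite_subset[OF _ finite_words[of s m]]) (auto simp: B_family_def)
  have upper: "card (deletion_shadow n (B_family s n k)) \<le> card (B_family s p k)"
    unfolding n by (intro card_mono fin shadow_B_family_subset)
  show ?thesis
  proof (cases "s = 1")
    case False
    then have "s - 1 > 0" using assms(3) by auto
    moreover have "vol (real (s - 1)) (Suc p) (real k + 1) \<le> real (card F)"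
      using assms(3,6) card_B_family[of s "Suc p" k] by (simp add: n)
    ultimately have "vol (real (s - 1)) p (real k + 1) \<le> real (card (deletion_shadow n F))"
      using shadow_lower_bound assms(5) unfolding n by blast
    then have "card (B_family s p k) \<le> card (deletion_shadow n F)"
      using assms(3) card_B_family[of s p k] by simp
    with upper show ?thesis by simp
  next
    \<comment> \<open>Over one letter the shadow of the ball has at most one word, so a nonempty
      shadow of \<open>F\<close> is enough.\<close>
    case True
    show ?thesis
    proof (cases "F = {}")
      case True
      then have "B_family s n k = {}" using assms(6) fin by simp
      then show ?thesis using True by simp
    next
      case False
      have "deletion_shadow n F \<noteq> {}"
        using False by (auto simp: n deletion_shadow_def delta_i_def)
      then have "card (deletion_shadow n F) \<ge> 1"
        using finite_subset[OF assms(5) finite_words]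
        by (simp add: Suc_le_eq card_gt_0_iff finite_deletion_shadow)
      moreover have "card (B_family s p k) \<le> 1"
      proof -
        have "B_family s p k \<subseteq> {replicate p 1}"
          using \<open>s = 1\<close> by (auto simp: B_family_def words_def intro!: replicate_eqI)
        then have "card (B_family s p k) \<le> card {replicate p (1::nat)}" by (intro card_mono) auto
        then show ?thesis by simp
      qed
      ultimately show ?thesis using upper by simp
    qed
  qed
qed

end
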